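(* As formal power series in $x$, $$(c_2^2 +c_3^2) e^{\alpha x}+(c_3^2+ c_1^2)e^{\beta x}+ (c_1^2+ c_2^2)e^{\gamma x}=\frac{-1}{22}\sum_{k=0}^\infty T_k^{(-4,1,4)}\frac{x^k}{k!}.$$
   Context: Let $\alpha,\beta,\gamma$ be the three distinct complex roots of $x^3-x^2-x-1=0$, and set $c_1=\frac{\alpha}{(\alpha-\beta)(\alpha-\gamma)}$, $c_2=\frac{\beta}{(\beta-\alpha)(\beta-\gamma)}$, $c_3=\frac{\gamma}{(\gamma-\alpha)(\gamma-\beta)}$. For numbers $s_0,s_1,s_2$, the sequence $T_k^{(s_0,s_1,s_2)}$ is defined by $T_0^{(s_0,s_1,s_2)}=s_0$, $T_1^{(s_0,s_1,s_2)}=s_1$, $T_2^{(s_0,s_1,s_2)}=s_2$ and $T_k^{(s_0,s_1,s_2)}=T_{k-1}^{(s_0,s_1,s_2)}+T_{k-2}^{(s_0,s_1,s_2)}+T_{k-3}^{(s_0,s_1,s_2)}$ for $k\ge3$. *)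

theory Defs
  imports Complex_Main "HOL-Computational_Algebra.Formal_Power_Series"
begin

fun trib :: "'a::plus \<Rightarrow> 'a \<Rightarrow> 'a \<Rightarrow> nat \<Rightarrow> 'a" where
  "trib s0 s1 s2 0 = s0"
| "trib s0 s1 s2 (Suc 0) = s1"
| "trib s0 s1 s2 (Suc (Suc 0)) = s2"
| "trib s0 s1 s2 (Suc (Suc (Suc k))) =
     trib s0 s1 s2 (Suc (Suc k)) + trib s0 s1 s2 (Suc k) + trib s0 s1 s2 k"

end

theory Submission
  imports Defs
begin

text \<open>
  Write $p(x) = x^3 - x^2 - x - 1$. Since $c_1 = \alpha / p'(\alpha)$, inverting $p'$ modulo $p$
  gives $22 c_1 = 5\alpha^2 - 3\alpha - 4$ and $44 c_1^2 = 1 + 4\alpha - \alpha^2$, and likewise for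
  the other roots. Both sides of the identity have coefficients (scaled by $k!$) obeying the
  tribonacci recurrence, so it suffices to compare $k = 0, 1, 2$; these are symmetric functions of
  the roots and follow from Vieta's formulas.
\<close>

text \<open>The second divided difference of $p$ at three distinct points is
  \<open>a + b + c - 1\<close>; it vanishes when $p$ vanishes at all three.\<close>

lemma tribonacci_roots_sum:
  fixes a b c :: "'a::idom"
  assumes "a ^ 3 - a ^ 2 - a - 1 = 0" "b ^ 3 - b ^ 2 - b - 1 = 0" "c ^ 3 - c ^ 2 - c - 1 = 0"
    and "a \<noteq> b" "b \<noteq> c" "c \<noteq> a"
  shows "a + b + c = 1"
proof -
  have "(a - b) * ((b - c) * ((c - a) * (a + b + c - 1))) = 0"
    using assms(1-3) by algebra
  with assms(4-6) show ?thesis by simp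
qed

text \<open>Substituting \<open>c = 1 - a - b\<close> turns the second factor below into minus the
  quotient $(p(a) - p(b)) / (a - b)$.\<close>

lemma tribonacci_roots_sum_products:
  fixes a b c :: "'a::idom"
  assumes "a ^ 3 - a ^ 2 - a - 1 = 0" "b ^ 3 - b ^ 2 - b - 1 = 0"
    and "a \<noteq> b" "a + b + c = 1"
  shows "a * b + b * c + c * a = -1"
proof -
  have "(a - b) * (a * b + b * c + c * a + 1) = 0"
    using assms(1,2,4) by algebra
  with assms(3) show ?thesis by (simp add: eq_neg_iff_add_eq_0)
qed

lemma tribonacci_coefficient_square:
  fixes a b c :: "'a::field_char_0"
  assumes root: "a ^ 3 - a ^ 2 - a - 1 = 0"
    and sum: "a + b + c = 1" and products: "a * b + b * c + c * a = -1"
    and "a \<noteq> b" "a \<noteq> c"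
  shows "44 * (a / ((a - b) * (a - c))) ^ 2 = 1 + 4 * a - a ^ 2"
proof -
  \<comment> \<open>By Vieta \<open>(a - b) * (a - c)\<close> equals $3a^2 - 2a - 1 = p'(a)$, so
    this is the claimed inverse modulo $p$ with denominators cleared.\<close>
  have "((a - b) * (a - c)) ^ 2 * (1 + 4 * a - a ^ 2) = 44 * a ^ 2"
    using root sum products by algebra
  with \<open>a \<noteq> b\<close> \<open>a \<noteq> c\<close> show ?thesis
    by (simp add: power_divide divide_eq_eq mult.commute)
qed

lemma trib_eq_power_combination:
  fixes a b c u v w r s0 s1 s2 :: "'a::comm_ring_1"
  assumes "a ^ 3 - a ^ 2 - a - 1 = 0" "b ^ 3 - b ^ 2 - b - 1 = 0" "c ^ 3 - c ^ 2 - c - 1 = 0"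
    and "u + v + w = r * s0"
    and "u * a + v * b + w * c = r * s1"
    and "u * a ^ 2 + v * b ^ 2 + w * c ^ 2 = r * s2"
  shows "u * a ^ k + v * b ^ k + w * c ^ k = r * trib s0 s1 s2 k"
  using assms(4-6)
proof (induction s0 s1 s2 k rule: trib.induct)
  have rec: "x ^ Suc (Suc (Suc k)) = x ^ Suc (Suc k) + x ^ Suc k + x ^ k"
    if "x ^ 3 - x ^ 2 - x - 1 = 0" for x :: 'a and k
  proof -
    have "x ^ 3 = x ^ 2 + x + 1" using that by (simp add: algebra_simps)
    then have "x ^ 3 * x ^ k = (x ^ 2 + x + 1) * x ^ k" by simp
    then show ?thesis by (simp add: algebra_simps power2_eq_square power3_eq_cube)
  qed
  case (4 s0 s1 s2 k)
  show ?case
    \<comment> \<open>Once both sides are split by the recurrence, the induction hypotheses, read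
      right to left, eliminate \<open>trib\<close> and leave a ring identity.\<close>
    unfolding trib.simps(4) rec[OF assms(1)] rec[OF assms(2)] rec[OF assms(3)] distrib_left
    by (simp only: "4.IH"[OF "4.prems", symmetric]) (simp add: algebra_simps)
qed (simp_all add: power2_eq_square)

theorem corollary3:
  fixes \<alpha> \<beta> \<gamma> c1 c2 c3 :: complex
  assumes roots: "{z :: complex. z ^ 3 - z ^ 2 - z - 1 = 0} = {\<alpha>, \<beta>, \<gamma>}"
    and distinct: "\<alpha> \<noteq> \<beta>" "\<beta> \<noteq> \<gamma>" "\<gamma> \<noteq> \<alpha>"
    and c1: "c1 = \<alpha> / ((\<alpha> - \<beta>) * (\<alpha> - \<gamma>))"
    and c2: "c2 = \<beta> / ((\<beta> - \<alpha>) * (\<beta> - \<gamma>))"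
    and c3: "c3 = \<gamma> / ((\<gamma> - \<alpha>) * (\<gamma> - \<beta>))"
  shows "fps_const (c2 ^ 2 + c3 ^ 2) * fps_exp \<alpha>
       + fps_const (c3 ^ 2 + c1 ^ 2) * fps_exp \<beta>
       + fps_const (c1 ^ 2 + c2 ^ 2) * fps_exp \<gamma>
       = fps_const (- 1 / 22) * Abs_fps (\<lambda>k. trib (- 4) 1 4 k / fact k)"
proof -
  have root: "\<alpha> ^ 3 - \<alpha> ^ 2 - \<alpha> - 1 = 0" "\<beta> ^ 3 - \<beta> ^ 2 - \<beta> - 1 = 0" "\<gamma> ^ 3 - \<gamma> ^ 2 - \<gamma> - 1 = 0"
    using roots by blast+
  have e1: "\<alpha> + \<beta> + \<gamma> = 1"
    using tribonacci_roots_sum[OF root distinct] .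
  have e2: "\<alpha> * \<beta> + \<beta> * \<gamma> + \<gamma> * \<alpha> = -1"
    using tribonacci_roots_sum_products[OF root(1,2) distinct(1) e1] .
  have sq1: "44 * c1 ^ 2 = 1 + 4 * \<alpha> - \<alpha> ^ 2"
    unfolding c1 using tribonacci_coefficient_square[OF root(1) e1 e2] distinct by simp
  have sq2: "44 * c2 ^ 2 = 1 + 4 * \<beta> - \<beta> ^ 2"
    unfolding c2 using tribonacci_coefficient_square[OF root(2), of \<alpha> \<gamma>] e1 e2 distinct
    by (simp add: ac_simps)
  have sq3: "44 * c3 ^ 2 = 1 + 4 * \<gamma> - \<gamma> ^ 2"
    unfolding c3 using tribonacci_coefficient_square[OF root(3), of \<alpha> \<beta>] e1 e2 distinct
    by (simp add: ac_simps)
  let ?u = "c2 ^ 2 + c3 ^ 2" and ?v = "c3 ^ 2 + c1 ^ 2" and ?w = "c1 ^ 2 + c2 ^ 2"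
  \<comment> \<open>Clearing denominators by 44 lets \<open>sq1\<close>, \<open>sq2\<close>,
    \<open>sq3\<close> apply and leaves polynomial goals for \<open>algebra\<close>.\<close>
  have scale: "x = (- 1 / 22) * y" if "44 * x = - 2 * y" for x y :: complex
    using arg_cong[OF that, of "\<lambda>z. z / 44"] by simp
  \<comment> \<open>The power sums of the roots are $p_1 = 1$, $p_2 = 3$, $p_3 = 7$, $p_4 = 11$.
    Hence $44(c_1^2 + c_2^2 + c_3^2) = 4$, and the three sums scaled by 44 are $8$, $4 - 6 = -2$ and
    $12 - 20 = -8$.\<close>
  have k0: "?u + ?v + ?w = (- 1 / 22) * (- 4)"
    by (rule scale) (use sq1 sq2 sq3 e1 e2 in algebra)
  have k1: "?u * \<alpha> + ?v * \<beta> + ?w * \<gamma> = (- 1 / 22) * 1"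
    by (rule scale) (use sq1 sq2 sq3 e1 e2 root in algebra)
  have k2: "?u * \<alpha> ^ 2 + ?v * \<beta> ^ 2 + ?w * \<gamma> ^ 2 = (- 1 / 22) * 4"
    by (rule scale) (use sq1 sq2 sq3 e1 e2 root in algebra)
  have "?u * \<alpha> ^ k + ?v * \<beta> ^ k + ?w * \<gamma> ^ k = (- 1 / 22) * trib (- 4) 1 4 k" for k
    using trib_eq_power_combination[OF root k0 k1 k2] .
  then have "(?u * \<alpha> ^ k + ?v * \<beta> ^ k + ?w * \<gamma> ^ k) / fact k
      = (- 1 / 22) * trib (- 4) 1 4 k / fact k" for k
    by (simp only:)
  then show ?thesis
    by (intro fps_ext) (simp add: add_divide_distrib)
qed

end
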